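(* Let $a, b > 0$ and consider the set of causal discrete-time LTI systems $$\mathcal{C}(a,b) = \{\mathcal{L} \mid |k_{\mathcal{L}}[t]| \le a e^{-bt}\ \text{for all } t \in \mathbb{N}_0\}.$$ The metric entropy of $\mathcal{C}(a,b)$ with respect to the metric $$\rho(\mathcal{L},\mathcal{L}') = \|K-K'\|_{\mathcal{H}^\infty} = \sup_{\|x\|_{\ell^2}=1} \|(k-k')*x\|_{\ell^2}$$ satisfies $$H(\epsilon;\mathcal{C}(a,b),\rho) \sim \frac{\gamma}{2b}\left(\log\left(\frac{a}{\epsilon}\right)\right)^2,$$ where $\gamma := \log_2(e)$ and $f(\epsilon)\sim g(\epsilon)$ stands for $\lim_{\epsilon\to 0}\left|\frac{f(\epsilon)}{g(\epsilon)}\right| = 1$.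
   Context: $\log$ is the natural logarithm, $\log_2$ the logarithm to base $2$, and $\mathbb{N}_0=\{0,1,2,\dots\}$. A (causal, discrete-time) LTI system $\mathcal{L}$ is given by its impulse response $k=k_{\mathcal{L}}$, a sequence with $k[t]=0$ for $t<0$, here real-valued, acting on one-sided inputs $x$ (with $x[t]=0$ for $t<0$) by convolution: $(\mathcal{L}x)[t] = (k*x)[t] = \sum_{\tau=0}^\infty k[\tau]\,x[t-\tau]$, $t\in\mathbb{N}_0$. Systems are identified with their impulse responses. The transfer function of $\mathcal{L}$ is $K(z)=\sum_{t=0}^\infty k[t]z^t$ for complex $|z|<1$ (note the positive exponents). $K,K'$ and $k,k'$ denote the transfer functions and impulse responses of $\mathcal{L},\mathcal{L}'$. The Hardy norm is $\|X\|_{\mathcal{H}^\infty} := \sup_{|z|<1}|X(z)|$. The suprema over $\|x\|_{\ell^2}=1$ range over one-sided square-summable sequences. Metric entropy: for a metric space $(\mathcal{X},\rho)$ and compact $\mathcal{C}\subseteq\mathcal{X}$, an $\epsilon$-covering of $\mathcal{C}$ is a set of points $\{x_1,\dots,x_N\}\subset\mathcal{C}$ such that for each $x\in\mathcal{C}$ there is an $i$ with $\rho(x,x_i)\le\epsilon$. The $\epsilon$-covering number $N(\epsilon;\mathcal{C},\rho)$ is the cardinality of a smallest $\epsilon$-covering of $\mathcal{C}$, and $H(\epsilon;\mathcal{C},\rho):=\log_2 N(\epsilon;\mathcal{C},\rho)$ is the metric entropy. Here $\mathcal{X}$ is the set of LTI systems with transfer function in $\mathcal{H}^\infty$ (i.e.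 of finite $\mathcal{H}^\infty$ norm), with metric $\rho(\mathcal{L},\mathcal{L}')=\|K-K'\|_{\mathcal{H}^\infty}$. *)

theory Defs
  imports "HOL-Analysis.Analysis"
begin

text \<open>
  A causal LTI system is identified with its real impulse response; indexing by \<^typ>\<open>nat\<close>
  encodes that it vanishes at negative times, and likewise for the one-sided inputs.
\<close>

type_synonym lti = "nat \<Rightarrow> real"

text \<open>
  Since inputs vanish at negative times, the terms of the convolution with delay beyond t are zero
  and the sum is finite.  The signal type is left polymorphic so that inputs may be real or complex.
\<close>

definition lti_apply :: "lti \<Rightarrow> (nat \<Rightarrow> 'a::real_normed_vector) \<Rightarrow> nat \<Rightarrow> 'a" where
  "lti_apply k x t = (\<Sum>\<tau>\<le>t. k \<tau> *\<^sub>R x (t - \<tau>))"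

text \<open>
  The norms below are extended reals, so that divergent sums and unbounded suprema
  have the value \<open>\<infinity>\<close>.
\<close>

definition l2_norm :: "(nat \<Rightarrow> 'a::real_normed_vector) \<Rightarrow> ereal" where
  "l2_norm x = (if summable (\<lambda>t. (norm (x t))\<^sup>2)
     then ereal (sqrt (\<Sum>t. (norm (x t))\<^sup>2)) else \<infinity>)"

definition transfer_function :: "lti \<Rightarrow> complex \<Rightarrow> complex" where
  "transfer_function k z = (\<Sum>t. complex_of_real (k t) * z ^ t)"

definition hardy_norm :: "(complex \<Rightarrow> complex) \<Rightarrow> ereal" where
  "hardy_norm X = (SUP z\<in>ball 0 1. ereal (norm (X z)))"

definition hardy_systems :: "lti set" where
  "hardy_systems = {k. (\<forall>z. norm z < 1 \<longrightarrow> summable (\<lambda>t. complex_of_real (k t) * z ^ t))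
     \<and> hardy_norm (transfer_function k) < \<infinity>}"

definition lti_dist :: "lti \<Rightarrow> lti \<Rightarrow> real" where
  "lti_dist k k' =
     real_of_ereal (hardy_norm (\<lambda>z. transfer_function k z - transfer_function k' z))"

definition exp_decaying_systems :: "real \<Rightarrow> real \<Rightarrow> lti set" where
  "exp_decaying_systems a b = {k. \<forall>t. \<bar>k t\<bar> \<le> a * exp (- b * real t)}"

definition is_covering :: "real \<Rightarrow> 'a set \<Rightarrow> ('a \<Rightarrow> 'a \<Rightarrow> real) \<Rightarrow> 'a set \<Rightarrow> bool" where
  "is_covering \<epsilon> C d S \<longleftrightarrow> finite S \<and> S \<subseteq> C \<and> (\<forall>x\<in>C. \<exists>y\<in>S. d x y \<le> \<epsilon>)"

text \<open>Only meaningful when a finite covering exists, e.g. for compact C and positive radius.\<close>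

definition covering_number :: "real \<Rightarrow> 'a set \<Rightarrow> ('a \<Rightarrow> 'a \<Rightarrow> real) \<Rightarrow> nat" where
  "covering_number \<epsilon> C d = (LEAST n. \<exists>S. is_covering \<epsilon> C d S \<and> card S = n)"

definition metric_entropy :: "real \<Rightarrow> 'a set \<Rightarrow> ('a \<Rightarrow> 'a \<Rightarrow> real) \<Rightarrow> real" where
  "metric_entropy \<epsilon> C d = log 2 (real (covering_number \<epsilon> C d))"

end

theory Submission
  imports Defs "HOL-Real_Asymp.Real_Asymp"
begin

text \<open>
  Two comparisons with norms of the impulse response carry the whole argument: the distance is at
  most the \<open>l1\<close> norm of \<open>k - k'\<close> (\<open>lti_dist_le_l1\<close>) and at least each single
  \<open>\<bar>k t - k' t\<bar>\<close> (\<open>coefficient_le_lti_dist\<close>).  So, up to lower order terms, the class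
  behaves like a box with sides \<open>2 a exp (- b t)\<close>.  With \<open>L = ln (a / \<epsilon>)\<close>, the coordinate \<open>t\<close> has
  about \<open>exp (L - b t)\<close> distinguishable values as long as \<open>t < L / b\<close> and just one afterwards.  The
  logarithm of the covering number is therefore about the area \<open>L ^ 2 / (2 b)\<close> of the triangle
  below the line \<open>L - b t\<close>.

  For an upper bound on the covering number, the response is cut off after \<open>T \<approx> L / b\<close> steps and
  the other coordinates are rounded to a grid of step \<open>\<epsilon> / (2 T)\<close>
  (\<open>exp_decaying_covering\<close>); the factor \<open>T\<close> costs only \<open>O(L ln L)\<close> in the exponent.  For a lower
  bound, responses on a grid of step \<open>3 \<epsilon>\<close> are pairwise more than \<open>2 \<epsilon>\<close> apart, so that no two of
  them can share a centre (\<open>exp_decaying_covering_card_ge\<close>).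

  The equality of the Hardy norm with the \<open>l2\<close> gain is proved without integration theory.
  That the gain is at most the Hardy norm is Parseval's identity on a circle, which for finitely
  supported signals can be evaluated over roots of unity (\<open>parseval_roots_of_unity\<close>,
  \<open>multiplier_bound_circle\<close>, \<open>lti_apply_l2_bound\<close>).  The converse pairs the output with the
  geometric signal \<open>z ^ t\<close>: this functional is an eigenvector of the adjoint of the system with
  eigenvalue \<open>K(z)\<close> (\<open>transfer_function_le_real_gain\<close>).  Compactness holds because on the class
  pointwise convergence is dominated by a summable sequence and hence implies \<open>l1\<close> convergence,
  and the class is a product of compact intervals (\<open>compactin_exp_decaying\<close>).
\<close>

section \<open>Parseval's identity over roots of unity\<close>

lemma roots_of_unity_orthogonal:
  fixes s t N :: nat
  assumes "s < N" "t < N"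
  shows "(\<Sum>j<N. cis (2 * pi * real j / real N) ^ s * cnj (cis (2 * pi * real j / real N) ^ t))
    = (if s = t then of_nat N else 0)"
proof -
  define z where "z = cis (2 * pi * (real s - real t) / real N)"
  have N: "N > 0" using assms by simp
  have summand: "cis (2 * pi * real j / real N) ^ s * cnj (cis (2 * pi * real j / real N) ^ t) = z ^ j" for j
  proof -
    have "real s * (2 * pi * real j / real N) - real t * (2 * pi * real j / real N)
        = real j * (2 * pi * (real s - real t) / real N)"
      using N by (simp add: field_simps)
    then show ?thesis by (simp add: z_def Complex.DeMoivre cis_cnj cis_mult)
  qed
  have "z ^ N = cis (2 * pi * (real s - real t))"
    using N by (simp add: z_def Complex.DeMoivre)
  also have "\<dots> = 1"
    by (metis cis_multiple_2pi Ints_diff Ints_of_nat mult.assoc)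
  finally have zN: "z ^ N = 1" .
  show ?thesis
  proof (cases "s = t")
    case True
    then show ?thesis unfolding summand by (simp add: z_def)
  next
    case False
    have "z \<noteq> 1"
    proof
      assume "z = 1"
      then have "cos (2 * pi * (real s - real t) / real N) = 1"
        by (simp add: z_def complex_eq_iff)
      then obtain n :: int where "2 * pi * (real s - real t) / real N = real_of_int n * 2 * pi"
        using cos_one_2pi_int by blast
      then have "pi * (real s - real t) = pi * (real_of_int n * real N)"
        using N by (simp add: field_simps)
      then have "real_of_int (int s - int t) = real_of_int (n * int N)"
        by simp
      then have e: "int s - int t = n * int N" by linarith
      then have "int N dvd (int s - int t)" by simp
      then have "\<bar>int s - int t\<bar> \<ge> int N \<or> int s - int t = 0"
        using zdvd_imp_le[of "int N" "\<bar>int s - int t\<bar>"] by auto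
      then show False using assms False by linarith
    qed
    then show ?thesis unfolding summand using geometric_sum[of z N] zN False
      by simp
  qed
qed

lemma parseval_roots_of_unity:
  fixes d :: "nat \<Rightarrow> complex"
  shows "(\<Sum>j<N. (cmod (\<Sum>t<N. d t * cis (2 * pi * real j / real N) ^ t))\<^sup>2)
    = real N * (\<Sum>t<N. (cmod (d t))\<^sup>2)"
proof -
  define w where "w = (\<lambda>j. cis (2 * pi * real j / real N))"
  have "complex_of_real (\<Sum>j<N. (cmod (\<Sum>t<N. d t * w j ^ t))\<^sup>2)
      = (\<Sum>j<N. (\<Sum>s<N. d s * w j ^ s) * (\<Sum>t<N. cnj (d t) * cnj (w j ^ t)))"
    by (simp only: of_real_sum complex_norm_square) (simp add: cnj_sum)
  also have "\<dots> = (\<Sum>j<N. \<Sum>s<N. \<Sum>t<N. d s * cnj (d t) * (w j ^ s * cnj (w j ^ t)))"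
    by (simp add: sum_product algebra_simps)
  also have "\<dots> = (\<Sum>s<N. \<Sum>j<N. \<Sum>t<N. d s * cnj (d t) * (w j ^ s * cnj (w j ^ t)))"
    by (rule sum.swap)
  also have "\<dots> = (\<Sum>s<N. \<Sum>t<N. \<Sum>j<N. d s * cnj (d t) * (w j ^ s * cnj (w j ^ t)))"
    by (intro sum.cong refl sum.swap)
  also have "\<dots> = (\<Sum>s<N. \<Sum>t<N. d s * cnj (d t) * (if s = t then of_nat N else 0))"
    unfolding sum_distrib_left[symmetric] w_def
    by (intro sum.cong refl arg_cong2[where f="(*)"] roots_of_unity_orthogonal) auto
  also have "\<dots> = (\<Sum>s<N. d s * cnj (d s) * of_nat N)"
    by (intro sum.cong refl) (simp add: if_distrib sum.delta' cong: if_cong)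
  also have "\<dots> = complex_of_real (real N * (\<Sum>t<N. (cmod (d t))\<^sup>2))"
    by (simp add: sum_distrib_left mult.commute complex_norm_square del: of_real_power)
  finally show ?thesis unfolding w_def using of_real_eq_iff by blast
qed

section \<open>The l2 gain is at most the Hardy norm\<close>

lemma lti_apply_complex:
  "lti_apply k (x :: nat \<Rightarrow> complex) t = (\<Sum>i\<le>t. complex_of_real (k i) * x (t - i))"
  by (simp add: lti_apply_def scaleR_conv_of_real)

text \<open>
  Only \<open>u 0, ..., u T\<close> enter the left-hand side, so \<open>u\<close> may be taken to be supported there.
  Truncating \<open>c\<close> at a large index changes its values on the unit circle by less than \<open>\<delta>\<close> and leaves the
  first \<open>T + 1\<close> output values alone.  Both factors are then polynomials, their product is evaluated
  at more roots of unity than its degree, and the identity above gives the bound with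
  \<open>B + \<delta>\<close> in place of \<open>B\<close>.
\<close>

lemma multiplier_bound_circle:
  fixes c u :: "nat \<Rightarrow> complex"
  assumes c: "summable (\<lambda>t. cmod (c t))"
    and B: "\<And>w. cmod w = 1 \<Longrightarrow> cmod (\<Sum>t. c t * w ^ t) \<le> B"
  shows "(\<Sum>t\<le>T. (cmod (\<Sum>i\<le>t. c i * u (t - i)))\<^sup>2) \<le> B\<^sup>2 * (\<Sum>t\<le>T. (cmod (u t))\<^sup>2)"
proof -
  define E where "E = (\<Sum>t\<le>T. (cmod (u t))\<^sup>2)"
  have E0: "E \<ge> 0" unfolding E_def by (intro sum_nonneg) auto
  have "0 \<le> cmod (\<Sum>t. c t * 1 ^ t)" by simp
  also have "\<dots> \<le> B" by (rule B) simp
  finally have B0: "B \<ge> 0" .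
  have le: "(\<Sum>t\<le>T. (cmod (\<Sum>i\<le>t. c i * u (t - i)))\<^sup>2) \<le> (B + \<delta>)\<^sup>2 * E" if "\<delta> > 0" for \<delta>
  proof -
    obtain m0 where m0: "\<And>n. n \<ge> m0 \<Longrightarrow> norm (\<Sum>i. cmod (c (i + n))) < \<delta>"
      using suminf_exist_split[OF \<open>\<delta> > 0\<close> c] by blast
    define m where "m = max m0 T"
    define p where "p = (\<lambda>i. if i \<le> m then c i else 0)"
    define q where "q = (\<lambda>i. if i \<le> T then u i else 0)"
    define d where "d = (\<lambda>t. \<Sum>i\<le>t. p i * q (t - i))"
    \<comment> \<open>The product of the truncations has degree at most \<open>m + T\<close>, so \<open>N\<close> nodes cause no aliasing.\<close>
    define N where "N = Suc (m + T)"
    define w where "w = (\<lambda>j. cis (2 * pi * real j / real N))"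
    have w1: "cmod (w j) = 1" for j by (simp add: w_def)
    have P: "cmod (\<Sum>i\<le>m. p i * w j ^ i) \<le> B + \<delta>" for j
    proof -
      have s: "summable (\<lambda>t. c t * w j ^ t)"
        by (rule summable_norm_cancel) (simp add: norm_mult norm_power w1 c)
      have "(\<Sum>t. c t * w j ^ t) = (\<Sum>t. c (t + Suc m) * w j ^ (t + Suc m)) + (\<Sum>i<Suc m. c i * w j ^ i)"
        by (rule suminf_split_initial_segment[OF s])
      then have "(\<Sum>i\<le>m. p i * w j ^ i) = (\<Sum>t. c t * w j ^ t) - (\<Sum>t. c (t + Suc m) * w j ^ (t + Suc m))"
        by (simp add: p_def lessThan_Suc_atMost)
      also have "cmod \<dots> \<le> cmod (\<Sum>t. c t * w j ^ t) + cmod (\<Sum>t. c (t + Suc m) * w j ^ (t + Suc m))"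
        by (rule norm_triangle_ineq4)
      also have "cmod (\<Sum>t. c t * w j ^ t) \<le> B" by (rule B) (rule w1)
      also have "cmod (\<Sum>t. c (t + Suc m) * w j ^ (t + Suc m)) \<le> (\<Sum>t. cmod (c (t + Suc m) * w j ^ (t + Suc m)))"
        by (rule summable_norm)
          (use summable_ignore_initial_segment[OF c, of "Suc m"] in \<open>simp add: norm_mult norm_power w1\<close>)
      also have "\<dots> = (\<Sum>t. cmod (c (t + Suc m)))" by (simp add: norm_mult norm_power w1)
      also have "\<dots> \<le> \<delta>"
      proof -
        have "m0 \<le> Suc m" by (simp add: m_def)
        from m0[OF this] show ?thesis by simp
      qed
      finally show ?thesis by simp
    qed
    have prod: "(\<Sum>i\<le>m. p i * w j ^ i) * (\<Sum>i\<le>T. q i * w j ^ i) = (\<Sum>t<N. d t * w j ^ t)" for j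
      unfolding d_def N_def lessThan_Suc_atMost
      by (rule polynomial_product) (auto simp: p_def q_def)
    have Q: "(\<Sum>i\<le>T. q i * w j ^ i) = (\<Sum>t<N. q t * w j ^ t)" for j
      by (rule sum.mono_neutral_left) (auto simp: N_def q_def)
    have "(\<Sum>t\<le>T. (cmod (\<Sum>i\<le>t. c i * u (t - i)))\<^sup>2) = (\<Sum>t\<le>T. (cmod (d t))\<^sup>2)"
      unfolding d_def p_def q_def m_def by (intro sum.cong refl arg_cong[where f="\<lambda>x. (cmod x)\<^sup>2"]) auto
    also have "\<dots> \<le> (\<Sum>t<N. (cmod (d t))\<^sup>2)"
      by (rule sum_mono2) (auto simp: N_def)
    finally have "real N * (\<Sum>t\<le>T. (cmod (\<Sum>i\<le>t. c i * u (t - i)))\<^sup>2) \<le> real N * (\<Sum>t<N. (cmod (d t))\<^sup>2)"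
      by (rule mult_left_mono) simp
    also have "\<dots> = (\<Sum>j<N. (cmod (\<Sum>t<N. d t * w j ^ t))\<^sup>2)"
      unfolding w_def by (rule parseval_roots_of_unity[symmetric])
    also have "\<dots> \<le> (\<Sum>j<N. (B + \<delta>)\<^sup>2 * (cmod (\<Sum>t<N. q t * w j ^ t))\<^sup>2)"
      unfolding prod[symmetric] Q[symmetric] norm_mult power_mult_distrib
      by (intro sum_mono mult_right_mono power_mono P) auto
    also have "\<dots> = (B + \<delta>)\<^sup>2 * (real N * (\<Sum>t<N. (cmod (q t))\<^sup>2))"
      unfolding w_def sum_distrib_left[symmetric] by (subst parseval_roots_of_unity) simp
    also have "(\<Sum>t<N. (cmod (q t))\<^sup>2) = E"
      unfolding E_def by (rule sum.mono_neutral_cong_right) (auto simp: N_def q_def)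
    finally have "real N * (\<Sum>t\<le>T. (cmod (\<Sum>i\<le>t. c i * u (t - i)))\<^sup>2) \<le> real N * ((B + \<delta>)\<^sup>2 * E)"
      by (simp add: mult_ac)
    then show ?thesis by (simp add: N_def del: of_nat_Suc)
  qed
  have "((\<lambda>\<delta>. (B + \<delta>)\<^sup>2 * E) \<longlongrightarrow> (B + 0)\<^sup>2 * E) (at_right 0)"
    by (intro tendsto_intros)
  then have "(\<Sum>t\<le>T. (cmod (\<Sum>i\<le>t. c i * u (t - i)))\<^sup>2) \<le> (B + 0)\<^sup>2 * E"
    by (rule tendsto_lowerbound) (auto intro!: eventually_at_right_less[THEN eventually_mono] le)
  then show ?thesis by (simp add: E_def)
qed

lemma summable_norm_transfer:
  assumes "\<And>z. cmod z < 1 \<Longrightarrow> summable (\<lambda>t. complex_of_real (k t) * z ^ t)" "cmod z < 1"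
  shows "summable (\<lambda>t. cmod (complex_of_real (k t) * z ^ t))"
proof -
  obtain r where r: "cmod z < r" "r < 1" using assms(2) dense by blast
  then have "r \<ge> 0" using norm_ge_zero[of z] by linarith
  have "summable (\<lambda>t. complex_of_real (k t) * complex_of_real r ^ t)"
    by (rule assms(1)) (use r \<open>r \<ge> 0\<close> in simp)
  then show ?thesis
    by (rule powser_insidea) (use r \<open>r \<ge> 0\<close> in simp)
qed

text \<open>
  The transfer function need not extend to the unit circle, so the bound is proved on the circles of
  radius \<open>r < 1\<close>, where the power series converges absolutely, and \<open>r\<close> then tends to 1.
\<close>

lemma lti_apply_l2_bound:
  fixes x :: "nat \<Rightarrow> complex"
  assumes k: "\<And>z. cmod z < 1 \<Longrightarrow> summable (\<lambda>t. complex_of_real (k t) * z ^ t)"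
    and B: "\<And>z. cmod z < 1 \<Longrightarrow> cmod (transfer_function k z) \<le> B"
  shows "(\<Sum>t\<le>T. (cmod (lti_apply k x t))\<^sup>2) \<le> B\<^sup>2 * (\<Sum>t\<le>T. (cmod (x t))\<^sup>2)"
proof -
  have le: "(\<Sum>t\<le>T. (r ^ t * cmod (lti_apply k x t))\<^sup>2) \<le> B\<^sup>2 * (\<Sum>t\<le>T. (r ^ t * cmod (x t))\<^sup>2)"
    if r: "0 < r" "r < 1" for r :: real
  proof -
    define R where "R = complex_of_real r"
    have R: "cmod R = r" using r by (simp add: R_def)
    have "(\<Sum>t\<le>T. (cmod (\<Sum>i\<le>t. (of_real (k i) * R ^ i) * (R ^ (t - i) * x (t - i))))\<^sup>2)
      \<le> B\<^sup>2 * (\<Sum>t\<le>T. (cmod (R ^ t * x t))\<^sup>2)"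
    proof (rule multiplier_bound_circle)
      show "summable (\<lambda>t. cmod (of_real (k t) * R ^ t))"
        by (rule summable_norm_transfer[OF k]) (use r R in auto)
      show "cmod (\<Sum>t. of_real (k t) * R ^ t * w ^ t) \<le> B" if "cmod w = 1" for w
      proof -
        have "(\<Sum>t. of_real (k t) * R ^ t * w ^ t) = transfer_function k (R * w)"
          by (simp add: transfer_function_def power_mult_distrib mult_ac)
        then show ?thesis using B[of "R * w"] that r R by (simp add: norm_mult)
      qed
    qed
    moreover have "(\<Sum>i\<le>t. (of_real (k i) * R ^ i) * (R ^ (t - i) * x (t - i))) = R ^ t * lti_apply k x t" for t
    proof -
      have "(of_real (k i) * R ^ i) * (R ^ (t - i) * x (t - i)) = R ^ t * (of_real (k i) * x (t - i))" if "i \<le> t" for i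
        using power_add[of R i "t - i"] that by (simp add: mult_ac)
      then show ?thesis unfolding lti_apply_complex sum_distrib_left by (intro sum.cong refl) simp
    qed
    ultimately show ?thesis by (simp add: norm_mult norm_power R)
  qed
  have l1: "((\<lambda>r. \<Sum>t\<le>T. (r ^ t * cmod (lti_apply k x t))\<^sup>2) \<longlongrightarrow> (\<Sum>t\<le>T. (1 ^ t * cmod (lti_apply k x t))\<^sup>2)) (at_left (1::real))"
    and l2: "((\<lambda>r. B\<^sup>2 * (\<Sum>t\<le>T. (r ^ t * cmod (x t))\<^sup>2)) \<longlongrightarrow> B\<^sup>2 * (\<Sum>t\<le>T. (1 ^ t * cmod (x t))\<^sup>2)) (at_left (1::real))"
    by (intro tendsto_intros)+
  have "eventually (\<lambda>r. 0 < r \<and> r < (1::real)) (at_left 1)"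
    using eventually_at_left_real[of 0 "1::real"] by (auto elim!: eventually_mono)
  then have "eventually (\<lambda>r. (\<Sum>t\<le>T. (r ^ t * cmod (lti_apply k x t))\<^sup>2) \<le> B\<^sup>2 * (\<Sum>t\<le>T. (r ^ t * cmod (x t))\<^sup>2)) (at_left 1)"
    by (rule eventually_mono) (use le in auto)
  from tendsto_le[OF _ l2 l1 this] show ?thesis by simp
qed

section \<open>The metric space of systems\<close>

lemma hardy_norm_le: "(\<And>z. cmod z < 1 \<Longrightarrow> cmod (X z) \<le> B) \<Longrightarrow> hardy_norm X \<le> ereal B"
  unfolding hardy_norm_def by (rule SUP_least) simp

lemma norm_le_hardy_norm: "cmod z < 1 \<Longrightarrow> ereal (cmod (X z)) \<le> hardy_norm X"
  unfolding hardy_norm_def by (rule SUP_upper) simp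

lemma hardy_norm_nonneg: "0 \<le> hardy_norm X"
proof -
  have "0 \<le> ereal (cmod (X 0))" by simp
  also have "\<dots> \<le> hardy_norm X" by (rule norm_le_hardy_norm) simp
  finally show ?thesis .
qed

lemma hardy_norm_add_le: "hardy_norm (\<lambda>z. X z + Y z) \<le> hardy_norm X + hardy_norm Y"
proof (unfold hardy_norm_def[of "\<lambda>z. X z + Y z"], rule SUP_least)
  fix z :: complex assume "z \<in> ball 0 1"
  then have z: "cmod z < 1" by simp
  have "ereal (cmod (X z + Y z)) \<le> ereal (cmod (X z)) + ereal (cmod (Y z))"
    by (simp add: norm_triangle_ineq)
  also have "\<dots> \<le> hardy_norm X + hardy_norm Y"
    by (intro add_mono norm_le_hardy_norm z)
  finally show "ereal (cmod (X z + Y z)) \<le> hardy_norm X + hardy_norm Y" .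
qed

lemma hardy_norm_uminus: "hardy_norm (\<lambda>z. - X z) = hardy_norm X"
  by (simp add: hardy_norm_def)

lemma lti_dist_nonneg: "0 \<le> lti_dist k k'"
  unfolding lti_dist_def by (simp add: hardy_norm_nonneg real_of_ereal_pos)

lemma lti_dist_commute: "lti_dist k k' = lti_dist k' k"
  unfolding lti_dist_def
  using hardy_norm_uminus[of "\<lambda>z. transfer_function k z - transfer_function k' z"] by simp

lemma hardy_systems_summable:
  "k \<in> hardy_systems \<Longrightarrow> cmod z < 1 \<Longrightarrow> summable (\<lambda>t. complex_of_real (k t) * z ^ t)"
  by (simp add: hardy_systems_def)

lemma transfer_function_diff:
  assumes "k \<in> hardy_systems" "k' \<in> hardy_systems" "cmod z < 1"
  shows "transfer_function (\<lambda>t. k t - k' t) z = transfer_function k z - transfer_function k' z"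
  using suminf_diff[OF hardy_systems_summable[OF assms(1,3)] hardy_systems_summable[OF assms(2,3)]]
  by (simp add: transfer_function_def algebra_simps)

text \<open>
  The conversion to a real number in the definition of the distance loses nothing here, because both
  transfer functions are bounded.
\<close>

lemma ereal_lti_dist:
  assumes "k \<in> hardy_systems" "k' \<in> hardy_systems"
  shows "ereal (lti_dist k k') = hardy_norm (\<lambda>z. transfer_function k z - transfer_function k' z)"
proof -
  let ?h = "hardy_norm (\<lambda>z. transfer_function k z - transfer_function k' z)"
  have "?h \<le> hardy_norm (transfer_function k) + hardy_norm (transfer_function k')"
    using hardy_norm_add_le[of "transfer_function k" "\<lambda>z. - transfer_function k' z"]
    by (simp add: hardy_norm_uminus)
  also have "\<dots> < \<infinity>" using assms by (auto simp: hardy_systems_def)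
  finally have "?h < \<infinity>" .
  moreover have "0 \<le> ?h" by (rule hardy_norm_nonneg)
  ultimately show ?thesis unfolding lti_dist_def by (intro ereal_real') auto
qed

lemma norm_transfer_diff_le:
  assumes "k \<in> hardy_systems" "k' \<in> hardy_systems" "cmod z < 1"
  shows "cmod (transfer_function (\<lambda>t. k t - k' t) z) \<le> lti_dist k k'"
  using norm_le_hardy_norm[OF assms(3), of "\<lambda>z. transfer_function k z - transfer_function k' z"]
  unfolding ereal_lti_dist[OF assms(1,2), symmetric] transfer_function_diff[OF assms] by simp

lemma hardy_systems_diff_summable:
  assumes "k \<in> hardy_systems" "k' \<in> hardy_systems" "cmod z < 1"
  shows "summable (\<lambda>t. complex_of_real (k t - k' t) * z ^ t)"
  using summable_diff[OF hardy_systems_summable[OF assms(1,3)] hardy_systems_summable[OF assms(2,3)]]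
  by (simp add: algebra_simps)

lemma lti_apply_diff_l2_bound:
  fixes x :: "nat \<Rightarrow> complex"
  assumes "k \<in> hardy_systems" "k' \<in> hardy_systems"
  shows "(\<Sum>t\<le>T. (cmod (lti_apply (\<lambda>t. k t - k' t) x t))\<^sup>2) \<le> (lti_dist k k')\<^sup>2 * (\<Sum>t\<le>T. (cmod (x t))\<^sup>2)"
  by (rule lti_apply_l2_bound) (use assms hardy_systems_diff_summable norm_transfer_diff_le in auto)

text \<open>
  The response to the unit impulse is the impulse response itself, so each of its entries is bounded
  by the gain.  This gives both the definiteness of the metric and the lower bound on the entropy.
\<close>

lemma coefficient_le_lti_dist:
  assumes "k \<in> hardy_systems" "k' \<in> hardy_systems"
  shows "\<bar>k t - k' t\<bar> \<le> lti_dist k k'"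
proof -
  define x :: "nat \<Rightarrow> complex" where "x = (\<lambda>t. if t = 0 then 1 else 0 :: complex)"
  have x: "(\<Sum>s\<le>t. (cmod (x s))\<^sup>2) = 1"
    using sum.delta[of "{..t}" 0 "\<lambda>_. 1::real"]
    by (simp add: x_def if_distrib[of cmod] if_distrib[of "\<lambda>x. x\<^sup>2"] cong: if_cong)
  have y: "lti_apply (\<lambda>t. k t - k' t) x t = of_real (k t - k' t)"
  proof -
    have "lti_apply (\<lambda>t. k t - k' t) x t = (\<Sum>i\<le>t. if i = t then of_real (k t - k' t) else 0)"
      unfolding lti_apply_complex by (rule sum.cong) (auto simp: x_def)
    then show ?thesis by simp
  qed
  have "(k t - k' t)\<^sup>2 = (cmod (lti_apply (\<lambda>t. k t - k' t) x t))\<^sup>2"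
    unfolding y norm_of_real by simp
  also have "\<dots> \<le> (\<Sum>s\<le>t. (cmod (lti_apply (\<lambda>t. k t - k' t) x s))\<^sup>2)"
    by (rule member_le_sum) auto
  also have "\<dots> \<le> (lti_dist k k')\<^sup>2"
    using lti_apply_diff_l2_bound[OF assms, of x t] by (simp add: x)
  finally show ?thesis using lti_dist_nonneg[of k k']
    by (metis abs_le_square_iff abs_of_nonneg)
qed

lemma Metric_space_hardy: "Metric_space hardy_systems lti_dist"
proof
  show "0 \<le> lti_dist k k'" for k k' by (rule lti_dist_nonneg)
  show "lti_dist k k' = lti_dist k' k" for k k' by (rule lti_dist_commute)
  show "lti_dist k k' = 0 \<longleftrightarrow> k = k'" if "k \<in> hardy_systems" "k' \<in> hardy_systems" for k k'
  proof
    assume "lti_dist k k' = 0"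
    with coefficient_le_lti_dist[OF that] have "k t = k' t" for t
      by (metis abs_le_zero_iff eq_iff_diff_eq_0)
    then show "k = k'" by blast
  next
    assume "k = k'"
    then show "lti_dist k k' = 0" by (simp add: lti_dist_def hardy_norm_def)
  qed
  show "lti_dist k1 k3 \<le> lti_dist k1 k2 + lti_dist k2 k3"
    if "k1 \<in> hardy_systems" "k2 \<in> hardy_systems" "k3 \<in> hardy_systems" for k1 k2 k3
  proof -
    have "ereal (lti_dist k1 k3) \<le> ereal (lti_dist k1 k2) + ereal (lti_dist k2 k3)"
      unfolding ereal_lti_dist[OF that(1,2)] ereal_lti_dist[OF that(1,3)] ereal_lti_dist[OF that(2,3)]
      using hardy_norm_add_le[of "\<lambda>z. transfer_function k1 z - transfer_function k2 z"
          "\<lambda>z. transfer_function k2 z - transfer_function k3 z"] by simp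
    then show ?thesis by simp
  qed
qed

section \<open>Absolutely summable impulse responses\<close>

lemma summable_absolutely_transfer:
  fixes k :: lti
  assumes "summable (\<lambda>t. \<bar>k t\<bar>)" "cmod z < 1"
  shows "summable (\<lambda>t. cmod (complex_of_real (k t) * z ^ t))"
    and "(\<Sum>t. cmod (complex_of_real (k t) * z ^ t)) \<le> (\<Sum>t. \<bar>k t\<bar>)"
proof -
  have le: "cmod (complex_of_real (k t) * z ^ t) \<le> \<bar>k t\<bar>" for t
    using assms(2) by (simp add: norm_mult norm_power mult_left_le power_le_one)
  show s: "summable (\<lambda>t. cmod (complex_of_real (k t) * z ^ t))"
    by (rule summable_comparison_test'[OF assms(1), of 0]) (use le in simp)
  show "(\<Sum>t. cmod (complex_of_real (k t) * z ^ t)) \<le> (\<Sum>t. \<bar>k t\<bar>)"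
    by (rule suminf_le[OF le s assms(1)])
qed

lemma norm_transfer_le_l1:
  fixes k :: lti
  assumes "summable (\<lambda>t. \<bar>k t\<bar>)" "cmod z < 1"
  shows "cmod (transfer_function k z) \<le> (\<Sum>t. \<bar>k t\<bar>)"
  using summable_norm[OF summable_absolutely_transfer(1)[OF assms]] summable_absolutely_transfer(2)[OF assms]
  unfolding transfer_function_def by simp

lemma absolutely_summable_in_hardy:
  fixes k :: lti
  assumes "summable (\<lambda>t. \<bar>k t\<bar>)"
  shows "k \<in> hardy_systems"
proof -
  have "hardy_norm (transfer_function k) \<le> ereal (\<Sum>t. \<bar>k t\<bar>)"
    by (rule hardy_norm_le) (rule norm_transfer_le_l1[OF assms])
  then have "hardy_norm (transfer_function k) < \<infinity>" by (auto simp: less_top[symmetric])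
  then show ?thesis
    using summable_absolutely_transfer(1)[OF assms] by (auto simp: hardy_systems_def intro: summable_norm_cancel)
qed

lemma lti_dist_le_l1:
  fixes k k' :: lti
  assumes "k \<in> hardy_systems" "k' \<in> hardy_systems" "summable (\<lambda>t. \<bar>k t - k' t\<bar>)"
  shows "lti_dist k k' \<le> (\<Sum>t. \<bar>k t - k' t\<bar>)"
proof -
  have "ereal (lti_dist k k') \<le> ereal (\<Sum>t. \<bar>k t - k' t\<bar>)"
    unfolding ereal_lti_dist[OF assms(1,2)]
    by (rule hardy_norm_le) (use norm_transfer_le_l1[OF assms(3)] transfer_function_diff[OF assms(1,2)] in simp)
  then show ?thesis by simp
qed

section \<open>The Hardy norm is the l2 gain\<close>

lemma l2_norm_le:
  assumes "0 \<le> B" "\<And>T. (\<Sum>t\<le>T. (norm (x t))\<^sup>2) \<le> B\<^sup>2"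
  shows "l2_norm x \<le> ereal B"
proof -
  have "(\<Sum>t<n. (norm (x t))\<^sup>2) \<le> B\<^sup>2" for n
    by (rule order_trans[OF sum_mono2 assms(2)[of n]]) auto
  then have s: "summable (\<lambda>t. (norm (x t))\<^sup>2)"
    and "(\<Sum>t. (norm (x t))\<^sup>2) \<le> B\<^sup>2"
    by (auto intro!: summableI_nonneg_bounded suminf_le_const)
  then have "sqrt (\<Sum>t. (norm (x t))\<^sup>2) \<le> sqrt (B\<^sup>2)" by (intro real_sqrt_le_mono)
  then show ?thesis using s assms(1) by (simp add: l2_norm_def)
qed

lemma l2_norm_leD:
  assumes "l2_norm x \<le> ereal B"
  shows "(\<Sum>t\<le>T. (norm (x t))\<^sup>2) \<le> B\<^sup>2"
proof -
  have s: "summable (\<lambda>t. (norm (x t))\<^sup>2)" and le: "sqrt (\<Sum>t. (norm (x t))\<^sup>2) \<le> B"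
    using assms by (auto simp: l2_norm_def split: if_splits)
  have n: "0 \<le> (\<Sum>t. (norm (x t))\<^sup>2)" by (rule suminf_nonneg[OF s]) simp
  have "(\<Sum>t\<le>T. (norm (x t))\<^sup>2) \<le> (\<Sum>t. (norm (x t))\<^sup>2)"
    by (rule sum_le_suminf[OF s]) auto
  also have "\<dots> = (sqrt (\<Sum>t. (norm (x t))\<^sup>2))\<^sup>2" using n by simp
  also have "\<dots> \<le> B\<^sup>2" by (rule power_mono[OF le]) (use n in simp)
  finally show ?thesis .
qed

lemma lti_apply_of_real:
  "lti_apply k (\<lambda>t. complex_of_real (x t)) t = complex_of_real (lti_apply k x t)"
  by (simp add: lti_apply_def scaleR_conv_of_real)

lemma l2_norm_of_real: "l2_norm (\<lambda>t. complex_of_real (x t)) = l2_norm x"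
  by (simp add: l2_norm_def)

lemma lti_apply_scaled: "lti_apply k (\<lambda>t. c * x t) t = c * lti_apply k (x :: nat \<Rightarrow> real) t"
  by (simp add: lti_apply_def sum_distrib_left mult_ac)

lemma l2_norm_unit_impulse: "l2_norm (\<lambda>t. if t = 0 then 1 else 0 :: real) = 1"
proof -
  have "(\<lambda>t::nat. (norm (if t = 0 then 1 else 0 :: real))\<^sup>2) = (\<lambda>t. if t = 0 then 1 else 0)"
    by auto
  then show ?thesis
    using sums_single[of 0 "\<lambda>_. 1::real"] by (simp add: l2_norm_def sums_iff one_ereal_def)
qed

lemma real_l2_gain_homogeneous:
  fixes x :: "nat \<Rightarrow> real"
  assumes gain: "\<And>x :: nat \<Rightarrow> real. l2_norm x = 1 \<Longrightarrow> l2_norm (lti_apply k x) \<le> ereal s"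
    and x: "summable (\<lambda>t. (x t)\<^sup>2)"
  shows "(\<Sum>t\<le>T. (lti_apply k x t)\<^sup>2) \<le> s\<^sup>2 * (\<Sum>t. (x t)\<^sup>2)"
proof (cases "(\<Sum>t. (x t)\<^sup>2) = 0")
  case True
  then have "x t = 0" for t using suminf_eq_zero_iff[OF x] by simp
  then show ?thesis by (simp add: lti_apply_def)
next
  case False
  define E where "E = (\<Sum>t. (x t)\<^sup>2)"
  have E: "E > 0" using False suminf_nonneg[OF x] by (simp add: E_def)
  define y where "y = (\<lambda>t. (1 / sqrt E) * x t)"
  have y2: "(norm (y t))\<^sup>2 = (1 / E) * (x t)\<^sup>2" for t
    using E by (simp add: y_def power_mult_distrib power_divide)
  have "l2_norm y = 1"
    unfolding l2_norm_def y2 using x E suminf_mult[OF x, of "1 / E"]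
    by (simp add: E_def one_ereal_def summable_divide)
  from l2_norm_leD[OF gain[OF this], of T]
  have "(\<Sum>t\<le>T. ((1 / sqrt E) * lti_apply k x t)\<^sup>2) \<le> s\<^sup>2"
    by (simp only: y_def lti_apply_scaled real_norm_def power2_abs)
  also have "(\<Sum>t\<le>T. ((1 / sqrt E) * lti_apply k x t)\<^sup>2) = (\<Sum>t\<le>T. (lti_apply k x t)\<^sup>2) / E"
    using E by (simp add: power_mult_distrib power_divide sum_divide_distrib)
  finally show ?thesis using E by (simp add: field_simps flip: E_def)
qed

text \<open>
  The functional \<open>y \<mapsto> (\<Sum>t. z ^ t * y t)\<close> turns the convolution into multiplication by \<open>K(z)\<close>.  At the
  input \<open>x t = cnj z ^ t\<close> both the functional and the squared \<open>l2\<close> norm are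
  \<open>G = 1 / (1 - |z|^2)\<close>, and by the Cauchy-Schwarz inequality the functional is at most
  \<open>sqrt G\<close> times the norm of the output, so that \<open>|K(z)| G \<le> s G\<close>.  Real inputs suffice because
  a real system acts separately on real and imaginary parts.
\<close>

lemma transfer_function_le_real_gain:
  assumes k: "\<And>z. cmod z < 1 \<Longrightarrow> summable (\<lambda>t. complex_of_real (k t) * z ^ t)"
    and gain: "\<And>x :: nat \<Rightarrow> real. l2_norm x = 1 \<Longrightarrow> l2_norm (lti_apply k x) \<le> ereal s"
    and s: "0 \<le> s" and z: "cmod z < 1"
  shows "cmod (transfer_function k z) \<le> s"
proof -
  define x where "x = (\<lambda>t. cnj z ^ t)"
  define y where "y = lti_apply k x"
  define G where "G = 1 / (1 - (cmod z)\<^sup>2)"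
  have z2: "(cmod z)\<^sup>2 < 1" using z by (simp add: power_less_one_iff abs_square_less_1)
  have G0: "G > 0" using z2 by (simp add: G_def)
  have x2: "(cmod (x t))\<^sup>2 = ((cmod z)\<^sup>2) ^ t" for t
    by (simp add: x_def norm_power power_mult[symmetric] mult.commute)
  have G: "(\<lambda>t. ((cmod z)\<^sup>2) ^ t) sums G"
    unfolding G_def by (rule geometric_sums) (use z2 in simp)
  have sx: "summable (\<lambda>t. (cmod (x t))\<^sup>2)" using G by (simp add: x2 sums_iff)
  have su: "summable (\<lambda>t. (Re (x t))\<^sup>2)" and sv: "summable (\<lambda>t. (Im (x t))\<^sup>2)"
    by (rule summable_comparison_test'[OF sx, of 0], simp add: cmod_power2)+
  have uv: "(\<Sum>t. (Re (x t))\<^sup>2) + (\<Sum>t. (Im (x t))\<^sup>2) = G"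
  proof -
    have "(\<Sum>t. (cmod (x t))\<^sup>2) = G" unfolding x2 by (rule sums_unique[OF G, symmetric])
    then show ?thesis using suminf_add[OF su sv] by (simp add: cmod_power2)
  qed
  have y2: "(cmod (y t))\<^sup>2 = (lti_apply k (\<lambda>t. Re (x t)) t)\<^sup>2 + (lti_apply k (\<lambda>t. Im (x t)) t)\<^sup>2" for t
    by (simp add: y_def cmod_power2 lti_apply_def)
  have ybound: "(\<Sum>t\<le>T. (cmod (y t))\<^sup>2) \<le> s\<^sup>2 * G" for T
    using real_l2_gain_homogeneous[OF gain su, of T] real_l2_gain_homogeneous[OF gain sv, of T]
    by (simp add: y2 sum.distrib uv[symmetric] distrib_left)
  have "(\<lambda>t. \<Sum>i\<le>t. (of_real (k i) * z ^ i) * (z ^ (t - i) * x (t - i)))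
      sums ((\<Sum>t. of_real (k t) * z ^ t) * (\<Sum>t. z ^ t * x t))"
  proof (rule Cauchy_product_sums)
    show "summable (\<lambda>t. cmod (of_real (k t) * z ^ t))"
      by (rule summable_norm_transfer[OF k z])
    show "summable (\<lambda>t. cmod (z ^ t * x t))"
      using sx by (simp add: x_def norm_mult norm_power power2_eq_square)
  qed
  moreover have "(\<Sum>t. z ^ t * x t) = of_real G"
  proof -
    have "z ^ t * x t = of_real (((cmod z)\<^sup>2) ^ t)" for t
      by (simp add: x_def power_mult_distrib[symmetric] complex_norm_square flip: of_real_power)
         (metis complex_norm_square of_real_power)
    then show ?thesis using sums_of_real[OF G, where 'a=complex] by (simp add: sums_iff)
  qed
  moreover have "(\<Sum>i\<le>t. (of_real (k i) * z ^ i) * (z ^ (t - i) * x (t - i))) = z ^ t * y t" for t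
  proof -
    have "(of_real (k i) * z ^ i) * (z ^ (t - i) * x (t - i)) = z ^ t * (of_real (k i) * x (t - i))" if "i \<le> t" for i
      using power_add[of z i "t - i"] that by (simp add: mult_ac)
    then show ?thesis unfolding y_def lti_apply_complex sum_distrib_left by (intro sum.cong refl) simp
  qed
  ultimately have lim: "(\<lambda>t. z ^ t * y t) sums (transfer_function k z * of_real G)"
    by (simp add: transfer_function_def)
  have bound: "cmod (\<Sum>t\<le>n. z ^ t * y t) \<le> s * G" for n
  proof -
    have "cmod (\<Sum>t\<le>n. z ^ t * y t) \<le> (\<Sum>t\<le>n. cmod z ^ t * cmod (y t))"
      by (rule order_trans[OF norm_sum]) (simp add: norm_mult norm_power)
    also have "\<dots> \<le> sqrt ((\<Sum>t\<le>n. (cmod z ^ t)\<^sup>2) * (\<Sum>t\<le>n. (cmod (y t))\<^sup>2))"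
      by (rule real_le_rsqrt) (rule Cauchy_Schwarz_ineq_sum)
    also have "(\<Sum>t\<le>n. (cmod z ^ t)\<^sup>2) \<le> G"
    proof -
      have "(\<Sum>t\<le>n. ((cmod z)\<^sup>2) ^ t) \<le> (\<Sum>t. ((cmod z)\<^sup>2) ^ t)"
        by (rule sum_le_suminf) (use G in \<open>auto simp: sums_iff\<close>)
      then show ?thesis using G by (simp add: sums_iff power_mult[symmetric] mult.commute)
    qed
    also have "sqrt (G * (\<Sum>t\<le>n. (cmod (y t))\<^sup>2)) \<le> sqrt (G * (s\<^sup>2 * G))"
      by (intro real_sqrt_le_mono mult_left_mono ybound) (use G0 in simp)
    also have "sqrt (G * (s\<^sup>2 * G)) = s * G"
      using G0 s by (simp add: real_sqrt_mult)
    finally show ?thesis by (simp add: mult_right_mono sum_nonneg)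
  qed
  have "(\<lambda>n. \<Sum>t\<le>n. z ^ t * y t) \<longlonglongrightarrow> transfer_function k z * of_real G"
    using lim by (simp add: sums_def_le)
  from Lim_norm_ubound[OF _ this] bound
  have "cmod (transfer_function k z * of_real G) \<le> s * G" by simp
  then show ?thesis using G0 by (simp add: norm_mult)
qed

lemma lti_dist_eq_l2_gain:
  assumes kk': "k \<in> hardy_systems" "k' \<in> hardy_systems"
  shows "ereal (lti_dist k k') = (SUP x\<in>{x :: nat \<Rightarrow> real. l2_norm x = 1}. l2_norm (lti_apply (\<lambda>t. k t - k' t) x))"
      (is "?d = ?R")
    and "ereal (lti_dist k k') = (SUP x\<in>{x :: nat \<Rightarrow> complex. l2_norm x = 1}. l2_norm (lti_apply (\<lambda>t. k t - k' t) x))"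
      (is "_ = ?C")
proof -
  let ?D = "\<lambda>t. k t - k' t"
  have RC: "?R \<le> ?C"
  proof (rule SUP_mono)
    fix x :: "nat \<Rightarrow> real" assume "x \<in> {x. l2_norm x = 1}"
    then have "(\<lambda>t. complex_of_real (x t)) \<in> {x. l2_norm x = 1}" by (simp add: l2_norm_of_real)
    moreover have "l2_norm (lti_apply ?D x) \<le> l2_norm (lti_apply ?D (\<lambda>t. complex_of_real (x t)))"
      by (simp add: lti_apply_of_real[abs_def] l2_norm_of_real)
    ultimately show "\<exists>y\<in>{x. l2_norm x = 1}. l2_norm (lti_apply ?D x) \<le> l2_norm (lti_apply ?D (y :: nat \<Rightarrow> complex))"
      by blast
  qed
  have Cd: "?C \<le> ?d"
  proof (rule SUP_least, rule l2_norm_le[OF lti_dist_nonneg])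
    fix x :: "nat \<Rightarrow> complex" and T assume "x \<in> {x. l2_norm x = 1}"
    then have x: "(\<Sum>t\<le>T. (cmod (x t))\<^sup>2) \<le> 1" using l2_norm_leD[of x 1 T] by (simp add: one_ereal_def)
    have "(\<Sum>t\<le>T. (cmod (lti_apply ?D x t))\<^sup>2) \<le> (lti_dist k k')\<^sup>2 * (\<Sum>t\<le>T. (cmod (x t))\<^sup>2)"
      by (rule lti_apply_diff_l2_bound[OF kk'])
    also have "\<dots> \<le> (lti_dist k k')\<^sup>2" using x by (intro mult_left_le) auto
    finally show "(\<Sum>t\<le>T. (norm (lti_apply ?D x t))\<^sup>2) \<le> (lti_dist k k')\<^sup>2" .
  qed
  have dR: "?d \<le> ?R"
  proof -
    have Rle: "l2_norm (lti_apply ?D x) \<le> ?R" if "l2_norm x = 1" for x :: "nat \<Rightarrow> real"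
      by (rule SUP_upper) (use that in simp)
    have "0 \<le> l2_norm y" for y :: "nat \<Rightarrow> real"
      by (auto simp: l2_norm_def suminf_nonneg)
    then have R0: "0 \<le> ?R" using Rle[OF l2_norm_unit_impulse] order_trans by blast
    obtain s where s: "?R = ereal s" "0 \<le> s"
      using R0 order_trans[OF RC Cd] by (cases ?R) auto
    have "cmod (transfer_function ?D z) \<le> s" if "cmod z < 1" for z
      by (rule transfer_function_le_real_gain)
        (use that hardy_systems_diff_summable[OF kk'] Rle s in auto)
    then have "hardy_norm (\<lambda>z. transfer_function k z - transfer_function k' z) \<le> ereal s"
      using transfer_function_diff[OF kk'] by (intro hardy_norm_le) simp
    then show ?thesis using s ereal_lti_dist[OF kk'] by simp
  qed
  show "?d = ?R" using RC Cd dR by (meson order_antisym order_trans)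
  show "?d = ?C" using RC Cd dR by (meson order_antisym order_trans)
qed

section \<open>Compactness of the exponentially decaying systems\<close>

lemma summable_exp_decay:
  fixes a b :: real
  assumes "b > 0"
  shows "summable (\<lambda>t. a * exp (- b * real t))"
    and "(\<Sum>t. a * exp (- b * real (t + T))) = a * exp (- b * real T) / (1 - exp (- b))"
proof -
  have e: "exp (- b * real t) = exp (- b) ^ t" for t
    by (simp add: exp_of_nat_mult[symmetric] mult.commute)
  have g: "(\<lambda>t. exp (- b) ^ t) sums (1 / (1 - exp (- b)))"
    by (rule geometric_sums) (use assms in simp)
  then show "summable (\<lambda>t. a * exp (- b * real t))"
    unfolding e by (intro summable_mult) (simp add: sums_iff)
  have "(\<lambda>t. (a * exp (- b) ^ T) * exp (- b) ^ t) sums ((a * exp (- b) ^ T) * (1 / (1 - exp (- b))))"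
    by (rule sums_mult[OF g])
  then show "(\<Sum>t. a * exp (- b * real (t + T))) = a * exp (- b * real T) / (1 - exp (- b))"
    unfolding e by (simp add: sums_iff power_add mult_ac)
qed

lemma exp_decaying_systems_summable:
  assumes "b > 0" "k \<in> exp_decaying_systems a b"
  shows "summable (\<lambda>t. \<bar>k t\<bar>)"
  by (rule summable_comparison_test'[OF summable_exp_decay(1)[OF assms(1), of a], of 0])
    (use assms(2) in \<open>simp add: exp_decaying_systems_def\<close>)

lemma exp_decaying_subset_hardy:
  assumes "b > 0"
  shows "exp_decaying_systems a b \<subseteq> hardy_systems"
  using absolutely_summable_in_hardy exp_decaying_systems_summable[OF assms] by blast

lemma exp_decaying_diff_summable:
  assumes "b > 0" "k \<in> exp_decaying_systems a b" "k' \<in> exp_decaying_systems a b"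
  shows "summable (\<lambda>t. \<bar>k t - k' t\<bar>)"
  by (rule summable_comparison_test'[OF summable_add[OF exp_decaying_systems_summable[OF assms(1,2)] exp_decaying_systems_summable[OF assms(1,3)]], of 0]) simp

text \<open>
  By Tychonoff's theorem, compactness holds in the topology of pointwise convergence.
\<close>

lemma compact_exp_decaying_pointwise: "compact (exp_decaying_systems a b)"
proof -
  have "compactin (product_topology (\<lambda>_::nat. euclidean :: real topology) UNIV)
      (PiE UNIV (\<lambda>t. {- (a * exp (- b * real t))..a * exp (- b * real t)}))"
    unfolding compactin_PiE by simp
  moreover have "PiE UNIV (\<lambda>t. {- (a * exp (- b * real t))..a * exp (- b * real t)}) = exp_decaying_systems a b"
  proof -
    have "{- B..B} = {x. \<bar>x\<bar> \<le> B}" for B :: real by auto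
    then show ?thesis unfolding exp_decaying_systems_def PiE_UNIV_domain by auto
  qed
  ultimately show ?thesis by (simp add: euclidean_product_topology)
qed

text \<open>
  A subsequence that converges pointwise converges also in \<open>l1\<close>, by dominated convergence for series,
  and the distance is at most the \<open>l1\<close> norm.
\<close>

lemma compactin_exp_decaying:
  assumes b: "b > 0"
  shows "compactin (Metric_space.mtopology hardy_systems lti_dist) (exp_decaying_systems a b)"
proof -
  let ?C = "exp_decaying_systems a b"
  interpret Metric_space hardy_systems lti_dist by (rule Metric_space_hardy)
  note sub = exp_decaying_subset_hardy[OF b, of a]
  have "\<exists>l r. l \<in> ?C \<and> strict_mono r \<and> limitin mtopology (\<sigma> \<circ> r) l sequentially"
    if \<sigma>: "range \<sigma> \<subseteq> ?C" for \<sigma> :: "nat \<Rightarrow> lti"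
  proof -
    have "seq_compact ?C"
      using compact_exp_decaying_pointwise compact_eq_seq_compact_metric by blast
    then obtain l r where l: "l \<in> ?C" and r: "strict_mono r" and lim: "(\<sigma> \<circ> r) \<longlonglongrightarrow> l"
      using seq_compactE[of ?C \<sigma>] \<sigma> by blast
    have mem: "\<sigma> (r n) \<in> ?C" for n using \<sigma> by blast
    have coord: "(\<lambda>n. \<sigma> (r n) t) \<longlonglongrightarrow> l t" for t
    proof -
      have "isCont (\<lambda>f :: lti. f t) l"
        using continuous_on_product_coordinates[of t] continuous_on_eq_continuous_at[OF open_UNIV] by blast
      from isCont_tendsto_compose[OF this lim] show ?thesis by simp
    qed
    have "(\<lambda>n. \<Sum>t. \<bar>\<sigma> (r n) t - l t\<bar>) \<longlonglongrightarrow> (\<Sum>t. 0)"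
    proof (rule tannerys_theorem[THEN conjunct2, THEN conjunct2])
      show "summable (\<lambda>t. (2 * a) * exp (- b * real t))" by (rule summable_exp_decay(1)[OF b])
      show "(\<lambda>n. \<bar>\<sigma> (r n) t - l t\<bar>) \<longlonglongrightarrow> 0" for t
        using tendsto_rabs[OF tendsto_diff[OF coord[of t] tendsto_const[of "l t"]]] by simp
      have "norm \<bar>\<sigma> (r n) t - l t\<bar> \<le> (2 * a) * exp (- b * real t)" for n t
      proof -
        have "\<bar>\<sigma> (r n) t\<bar> \<le> a * exp (- b * real t)" "\<bar>l t\<bar> \<le> a * exp (- b * real t)"
          using mem[of n] l by (auto simp: exp_decaying_systems_def)
        then show ?thesis by simp
      qed
      then show "\<forall>\<^sub>F (t, n) in at_top \<times>\<^sub>F sequentially. norm \<bar>\<sigma> (r n) t - l t\<bar> \<le> (2 * a) * exp (- b * real t)"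
        by (intro always_eventually) auto
    qed simp
    then have l1: "(\<lambda>n. \<Sum>t. \<bar>\<sigma> (r n) t - l t\<bar>) \<longlonglongrightarrow> 0" by simp
    have "(\<lambda>n. lti_dist (\<sigma> (r n)) l) \<longlonglongrightarrow> 0"
    proof (rule tendsto_sandwich[OF _ _ tendsto_const l1])
      show "\<forall>\<^sub>F n in sequentially. lti_dist (\<sigma> (r n)) l \<le> (\<Sum>t. \<bar>\<sigma> (r n) t - l t\<bar>)"
        using mem l sub
        by (intro always_eventually allI lti_dist_le_l1 exp_decaying_diff_summable[OF b]) auto
    qed (simp add: lti_dist_nonneg)
    moreover have "\<forall>\<^sub>F n in sequentially. \<sigma> (r n) \<in> hardy_systems" using mem sub by (intro always_eventually) auto
    ultimately have "limitin mtopology (\<sigma> \<circ> r) l sequentially"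
      unfolding limitin_metric_dist_null using l sub by (auto simp: o_def)
    then show ?thesis using l r by blast
  qed
  then show ?thesis unfolding compactin_sequentially using sub by blast
qed

section \<open>Covering numbers and separated sets\<close>

lemma covering_number_le:
  "is_covering \<epsilon> C d S \<Longrightarrow> covering_number \<epsilon> C d \<le> card S"
  unfolding covering_number_def by (rule Least_le) blast

lemma covering_number_attained:
  assumes "is_covering \<epsilon> C d S"
  obtains S' where "is_covering \<epsilon> C d S'" "card S' = covering_number \<epsilon> C d"
proof -
  have "\<exists>S'. is_covering \<epsilon> C d S' \<and> card S' = covering_number \<epsilon> C d"
    unfolding covering_number_def by (rule LeastI[of _ "card S"]) (use assms in blast)
  then show ?thesis using that by blast
qed

lemma (in Metric_space) separated_card_le_covering:
  assumes "C \<subseteq> M" "is_covering \<epsilon> C d S" "P \<subseteq> C"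
    and sep: "\<And>x y. x \<in> P \<Longrightarrow> y \<in> P \<Longrightarrow> x \<noteq> y \<Longrightarrow> 2 * \<epsilon> < d x y"
  shows "card P \<le> card S"
proof -
  have S: "finite S" "S \<subseteq> C" using assms by (auto simp: is_covering_def)
  have "\<exists>y\<in>S. d x y \<le> \<epsilon>" if "x \<in> P" for x using assms that by (auto simp: is_covering_def)
  then obtain f where f: "\<And>x. x \<in> P \<Longrightarrow> f x \<in> S \<and> d x (f x) \<le> \<epsilon>" by metis
  have "inj_on f P"
  proof (rule inj_onI, rule ccontr)
    fix x y assume xy: "x \<in> P" "y \<in> P" "f x = f y" "x \<noteq> y"
    have m: "x \<in> M" "y \<in> M" "f x \<in> M" using xy f S assms by auto
    have "d x y \<le> d x (f x) + d (f x) y" by (rule triangle[OF m(1,3,2)])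
    also have "\<dots> \<le> \<epsilon> + \<epsilon>" using f[OF xy(1)] f[OF xy(2)] xy(3) commute[of "f x" y] by (intro add_mono) auto
    finally show False using sep[OF xy(1,2,4)] by simp
  qed
  then show ?thesis using f S by (intro card_inj_on_le) auto
qed

section \<open>Coverings and packings of the exponentially decaying systems\<close>

text \<open>
  Rounding towards zero never increases the absolute value, so the rounded responses
  remain in the class; the centres of a covering have to lie there.
\<close>

lemma quantize_toward_zero:
  fixes x \<delta> :: real
  assumes "\<delta> > 0"
  obtains m :: int where "\<bar>of_int m\<bar> * \<delta> \<le> \<bar>x\<bar>" "\<bar>x - \<delta> * of_int m\<bar> \<le> \<delta>"
proof -
  define n where "n = \<lfloor>\<bar>x\<bar> / \<delta>\<rfloor>"
  have n: "of_int n \<le> \<bar>x\<bar> / \<delta>" "\<bar>x\<bar> / \<delta> \<le> of_int n + 1" "n \<ge> 0"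
    using assms by (auto simp: n_def)
  then have n': "of_int n * \<delta> \<le> \<bar>x\<bar>" "\<bar>x\<bar> \<le> of_int n * \<delta> + \<delta>"
    using assms by (auto simp: field_simps)
  show ?thesis
  proof (cases "x \<ge> 0")
    case True
    then show ?thesis using n n' by (intro that[of n]) (auto simp: mult.commute abs_le_iff)
  next
    case False
    then show ?thesis using n n' by (intro that[of "- n"]) (auto simp: mult.commute abs_le_iff)
  qed
qed

lemma quantizer_levels:
  fixes \<beta> \<delta> :: real
  assumes "\<delta> > 0" "\<beta> \<ge> 0"
  shows "finite {m::int. \<bar>of_int m\<bar> * \<delta> \<le> \<beta>}"
    and "real (card {m::int. \<bar>of_int m\<bar> * \<delta> \<le> \<beta>}) \<le> 1 + 2 * \<beta> / \<delta>"
proof -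
  define n where "n = \<lfloor>\<beta> / \<delta>\<rfloor>"
  have n: "n \<ge> 0" "of_int n \<le> \<beta> / \<delta>" using assms by (auto simp: n_def)
  have sub: "{m::int. \<bar>of_int m\<bar> * \<delta> \<le> \<beta>} \<subseteq> {-n..n}"
  proof
    fix m :: int assume "m \<in> {m. \<bar>of_int m\<bar> * \<delta> \<le> \<beta>}"
    then have "of_int \<bar>m\<bar> \<le> \<beta> / \<delta>" using assms by (simp add: field_simps)
    then have "\<bar>m\<bar> \<le> n" unfolding n_def by (rule le_floor_iff[THEN iffD2])
    then show "m \<in> {-n..n}" by auto
  qed
  then show "finite {m::int. \<bar>of_int m\<bar> * \<delta> \<le> \<beta>}" by (rule finite_subset) simp
  have "card {m::int. \<bar>of_int m\<bar> * \<delta> \<le> \<beta>} \<le> card {-n..n}" by (rule card_mono[OF _ sub]) simp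
  then have "real (card {m::int. \<bar>of_int m\<bar> * \<delta> \<le> \<beta>}) \<le> real (nat (2 * n + 1))" by simp
  also have "\<dots> = 2 * of_int n + 1" using n by simp
  also have "\<dots> \<le> 1 + 2 * \<beta> / \<delta>" using n by simp
  finally show "real (card {m::int. \<bar>of_int m\<bar> * \<delta> \<le> \<beta>}) \<le> 1 + 2 * \<beta> / \<delta>" .
qed

text \<open>
  The error budget \<open>\<epsilon>\<close> is halved: one half pays for the discarded tail, the other for the rounding of
  \<open>T\<close> coordinates with step \<open>\<epsilon> / (2 T)\<close>, both measured in \<open>l1\<close>.
\<close>

lemma exp_decaying_covering:
  fixes a b \<epsilon> :: real
  assumes a: "a > 0" and b: "b > 0" and \<epsilon>: "\<epsilon> > 0" and T: "T > 0"
    and tail: "a * exp (- b * real T) / (1 - exp (- b)) \<le> \<epsilon> / 2"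
  obtains S where "is_covering \<epsilon> (exp_decaying_systems a b) lti_dist S"
    and "real (card S) \<le> (\<Prod>t<T. 1 + 4 * real T * (a * exp (- b * real t) / \<epsilon>))"
proof -
  let ?C = "exp_decaying_systems a b"
  define \<delta> where "\<delta> = \<epsilon> / (2 * real T)"
  have \<delta>: "\<delta> > 0" using \<epsilon> T by (simp add: \<delta>_def)
  define I where "I = (\<lambda>t. {m::int. \<bar>of_int m\<bar> * \<delta> \<le> a * exp (- b * real t)})"
  define sys :: "(nat \<Rightarrow> int) \<Rightarrow> lti" where "sys = (\<lambda>m t. if t < T then \<delta> * of_int (m t) else 0)"
  define S where "S = sys ` PiE {..<T} I"
  have fin: "finite (I t)" and cardI: "real (card (I t)) \<le> 1 + 4 * real T * (a * exp (- b * real t) / \<epsilon>)" for t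
    using quantizer_levels[OF \<delta>, of "a * exp (- b * real t)"] a \<epsilon> T
    by (auto simp: I_def \<delta>_def field_simps)
  have finP: "finite (PiE {..<T} I)" by (intro finite_PiE fin) simp
  have "card S \<le> card (PiE {..<T} I)" unfolding S_def by (rule card_image_le[OF finP])
  then have "real (card S) \<le> (\<Prod>t<T. real (card (I t)))" by (simp add: card_PiE flip: of_nat_prod)
  also have "\<dots> \<le> (\<Prod>t<T. 1 + 4 * real T * (a * exp (- b * real t) / \<epsilon>))"
    by (intro prod_mono conjI cardI) simp
  finally have card: "real (card S) \<le> (\<Prod>t<T. 1 + 4 * real T * (a * exp (- b * real t) / \<epsilon>))" .
  have SC: "S \<subseteq> ?C"
  proof
    fix s assume "s \<in> S"
    then obtain m where m: "m \<in> PiE {..<T} I" "s = sys m" by (auto simp: S_def)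
    have "\<bar>s t\<bar> \<le> a * exp (- b * real t)" for t
    proof (cases "t < T")
      case True
      then have "m t \<in> I t" using m by auto
      then show ?thesis using True m \<delta> by (simp add: sys_def I_def abs_mult mult.commute)
    next
      case False
      then show ?thesis using a m by (simp add: sys_def)
    qed
    then show "s \<in> ?C" by (simp add: exp_decaying_systems_def)
  qed
  have "\<exists>s\<in>S. lti_dist k s \<le> \<epsilon>" if k: "k \<in> ?C" for k
  proof -
    have kt: "\<bar>k t\<bar> \<le> a * exp (- b * real t)" for t using k by (simp add: exp_decaying_systems_def)
    have "\<exists>m::int. \<bar>of_int m\<bar> * \<delta> \<le> \<bar>k t\<bar> \<and> \<bar>k t - \<delta> * of_int m\<bar> \<le> \<delta>" for t
      using quantize_toward_zero[OF \<delta>] by metis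
    then obtain m :: "nat \<Rightarrow> int" where m: "\<And>t. \<bar>of_int (m t)\<bar> * \<delta> \<le> \<bar>k t\<bar>" "\<And>t. \<bar>k t - \<delta> * of_int (m t)\<bar> \<le> \<delta>"
      by metis
    define s where "s = sys (restrict m {..<T})"
    have "m t \<in> I t" for t
      using m(1)[of t] kt[of t] by (simp add: I_def)
    then have "restrict m {..<T} \<in> PiE {..<T} I" by (intro restrict_PiE_iff[THEN iffD2]) simp
    then have sS: "s \<in> S" unfolding S_def s_def by (rule imageI)
    then have sC: "s \<in> ?C" using SC by blast
    note sm = exp_decaying_diff_summable[OF b k sC]
    have "lti_dist k s \<le> (\<Sum>t. \<bar>k t - s t\<bar>)"
      using exp_decaying_subset_hardy[OF b] k sC by (intro lti_dist_le_l1 sm) auto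
    also have "\<dots> = (\<Sum>t. \<bar>k (t + T) - s (t + T)\<bar>) + (\<Sum>t<T. \<bar>k t - s t\<bar>)"
      by (rule suminf_split_initial_segment[OF sm])
    also have "(\<Sum>t<T. \<bar>k t - s t\<bar>) \<le> (\<Sum>t<T. \<delta>)"
      by (intro sum_mono) (simp add: s_def sys_def m)
    also have "(\<Sum>t<T. \<delta>) = \<epsilon> / 2" using T by (simp add: \<delta>_def)
    also have "(\<Sum>t. \<bar>k (t + T) - s (t + T)\<bar>) \<le> (\<Sum>t. a * exp (- b * real (t + T)))"
    proof (rule suminf_le)
      show "\<bar>k (t + T) - s (t + T)\<bar> \<le> a * exp (- b * real (t + T))" for t
        using kt[of "t + T"] by (simp add: s_def sys_def)
    qed (use summable_ignore_initial_segment[OF sm, of T]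
          summable_ignore_initial_segment[OF summable_exp_decay(1)[OF b, of a], of T] in auto)
    also have "\<dots> \<le> \<epsilon> / 2" unfolding summable_exp_decay(2)[OF b] by (rule tail)
    finally have "lti_dist k s \<le> \<epsilon>" by simp
    then show ?thesis using sS by blast
  qed
  then have "is_covering \<epsilon> ?C lti_dist S"
    using SC finP by (simp add: is_covering_def S_def)
  then show ?thesis using card by (rule that)
qed

text \<open>
  Responses that differ in some coordinate on a grid of step \<open>3 \<epsilon>\<close> are at distance at least \<open>3 \<epsilon>\<close>,
  and a ball of radius \<open>\<epsilon>\<close> contains at most one of them.
\<close>

lemma exp_decaying_covering_card_ge:
  fixes a b \<epsilon> :: real
  assumes a: "a > 0" and b: "b > 0" and \<epsilon>: "\<epsilon> > 0"
    and S: "is_covering \<epsilon> (exp_decaying_systems a b) lti_dist S"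
  shows "(\<Prod>t<T. a * exp (- b * real t) / (3 * \<epsilon>)) \<le> real (card S)"
proof -
  let ?C = "exp_decaying_systems a b"
  interpret Metric_space hardy_systems lti_dist by (rule Metric_space_hardy)
  define n where "n = (\<lambda>t. nat \<lfloor>a * exp (- b * real t) / (3 * \<epsilon>)\<rfloor>)"
  have n: "real (n t) \<le> a * exp (- b * real t) / (3 * \<epsilon>)" "a * exp (- b * real t) / (3 * \<epsilon>) \<le> real (Suc (n t))" for t
  proof -
    have "0 \<le> a * exp (- b * real t) / (3 * \<epsilon>)" using a \<epsilon> by simp
    then show "real (n t) \<le> a * exp (- b * real t) / (3 * \<epsilon>)" "a * exp (- b * real t) / (3 * \<epsilon>) \<le> real (Suc (n t))"
      unfolding n_def by linarith+
  qed
  define sys :: "(nat \<Rightarrow> nat) \<Rightarrow> lti" where "sys = (\<lambda>m t. if t < T then 3 * \<epsilon> * real (m t) else 0)"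
  define F where "F = PiE {..<T} (\<lambda>t. {..n t})"
  have mem: "sys m \<in> ?C" if "m \<in> F" for m
  proof -
    have "\<bar>sys m t\<bar> \<le> a * exp (- b * real t)" for t
    proof (cases "t < T")
      case True
      then have "m t \<le> n t" using that by (auto simp: F_def)
      then have "3 * \<epsilon> * real (m t) \<le> 3 * \<epsilon> * real (n t)" using \<epsilon> by simp
      also have "\<dots> \<le> a * exp (- b * real t)" using n(1)[of t] \<epsilon> by (simp add: field_simps)
      finally show ?thesis using True \<epsilon> by (simp add: sys_def)
    next
      case False
      then show ?thesis using a by (simp add: sys_def)
    qed
    then show ?thesis by (simp add: exp_decaying_systems_def)
  qed
  have sep: "2 * \<epsilon> < lti_dist (sys m) (sys m')" if mm': "m \<in> F" "m' \<in> F" "m \<noteq> m'" for m m'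
  proof -
    obtain t where t: "t < T" "m t \<noteq> m' t"
      using PiE_ext[of m "{..<T}" _ m'] mm' unfolding F_def by blast
    then have "\<bar>real (m t) - real (m' t)\<bar> \<ge> 1" by linarith
    then have "3 * \<epsilon> * 1 \<le> 3 * \<epsilon> * \<bar>real (m t) - real (m' t)\<bar>" using \<epsilon> by (intro mult_left_mono) auto
    also have "\<dots> = \<bar>sys m t - sys m' t\<bar>" using t \<epsilon> by (simp add: sys_def abs_mult flip: right_diff_distrib)
    also have "\<dots> \<le> lti_dist (sys m) (sys m')"
      using mem mm' exp_decaying_subset_hardy[OF b] by (intro coefficient_le_lti_dist) auto
    finally show ?thesis using \<epsilon> by simp
  qed
  have inj: "inj_on sys F"
  proof (rule inj_onI, rule ccontr)
    fix m m' assume m: "m \<in> F" "m' \<in> F" "sys m = sys m'" "m \<noteq> m'"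
    have "sys m' \<in> hardy_systems" using mem[OF m(2)] exp_decaying_subset_hardy[OF b] by blast
    then have "lti_dist (sys m) (sys m') = 0" using m(3) by simp
    then show False using sep[OF m(1,2,4)] \<epsilon> by simp
  qed
  have "(\<Prod>t<T. a * exp (- b * real t) / (3 * \<epsilon>)) \<le> (\<Prod>t<T. real (Suc (n t)))"
    by (intro prod_mono conjI n) (use a \<epsilon> in simp)
  also have "\<dots> = real (card (sys ` F))"
    unfolding card_image[OF inj] by (simp add: F_def card_PiE)
  also have "\<dots> \<le> real (card S)"
    using separated_card_le_covering[OF exp_decaying_subset_hardy[OF b] S, of "sys ` F"] mem sep by auto
  finally show ?thesis .
qed

section \<open>Asymptotics of the metric entropy\<close>

lemma sum_of_nat_lessThan: "(\<Sum>t<T. real t) = real T * (real T - 1) / 2"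
  by (induction T) (auto simp: field_simps)

text \<open>
  The constant \<open>c\<close> accounts for the geometric tail sum: the
  bound on the truncation error is at most \<open>\<epsilon> / 2\<close> exactly if \<open>L + c \<le> b T\<close>.  Since \<open>T\<close> is the least such number,
  \<open>1 \<le> exp c * exp (L - b t)\<close> for all \<open>t < T\<close>, which absorbs the summand 1 of each factor.
\<close>

lemma exp_decaying_covering_log_card:
  fixes a b \<epsilon> :: real
  assumes "a > 0" "b > 0" "\<epsilon> > 0"
  defines "L \<equiv> ln (a / \<epsilon>)" and "c \<equiv> ln (2 / (1 - exp (- b)))"
  assumes T: "T > 0" "(L + c) / b \<le> real T" "real T < (L + c) / b + 1"
  obtains S where "is_covering \<epsilon> (exp_decaying_systems a b) lti_dist S"
    and "ln (real (card S)) \<le> real T * (ln (exp c + 4 * real T) + L) - b * (real T * (real T - 1) / 2)"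
proof -
  have q: "1 - exp (- b) > 0" using assms by simp
  have ec: "exp c = 2 / (1 - exp (- b))" using q by (simp add: c_def)
  have eL: "a * exp (- b * real t) / \<epsilon> = exp (L - b * real t)" for t
    using assms(1,3) by (simp add: L_def exp_diff exp_minus field_simps)
  have "L + c \<le> b * real T" using T assms by (simp add: field_simps)
  then have "exp (L - b * real T) \<le> exp (- c)" by simp
  then have tl: "a * exp (- b * real T) / (1 - exp (- b)) \<le> \<epsilon> / 2"
    unfolding eL[symmetric] exp_minus[of c] ec using q assms(3) by (simp add: field_simps)
  obtain S where S: "is_covering \<epsilon> (exp_decaying_systems a b) lti_dist S"
    and card: "real (card S) \<le> (\<Prod>t<T. 1 + 4 * real T * (a * exp (- b * real t) / \<epsilon>))"
    using exp_decaying_covering[OF assms(1-3) T(1) tl] by blast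
  have "(\<lambda>t. 0) \<in> exp_decaying_systems a b" using assms(1) by (simp add: exp_decaying_systems_def)
  then have "S \<noteq> {}" using S by (auto simp: is_covering_def)
  then have cp: "card S > 0" using S by (auto simp: is_covering_def card_gt_0_iff)
  have pos: "exp c + 4 * real T > 0" by (intro add_pos_nonneg) auto
  have "real (card S) \<le> (\<Prod>t<T. (exp c + 4 * real T) * exp (L - b * real t))"
  proof (rule order_trans[OF card], intro prod_mono conjI)
    fix t assume "t \<in> {..<T}"
    then have "real t \<le> real T - 1" by (simp add: of_nat_diff)
    then have "real t \<le> (L + c) / b" using T by linarith
    then have "b * real t \<le> L + c" using assms(2) by (simp add: field_simps)
    then have "1 \<le> exp c * exp (L - b * real t)" by (simp flip: exp_add)
    then show "1 + 4 * real T * (a * exp (- b * real t) / \<epsilon>) \<le> (exp c + 4 * real T) * exp (L - b * real t)"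
      unfolding eL by (simp add: distrib_right)
    show "0 \<le> 1 + 4 * real T * (a * exp (- b * real t) / \<epsilon>)" using assms by simp
  qed
  then have "ln (real (card S)) \<le> ln (\<Prod>t<T. (exp c + 4 * real T) * exp (L - b * real t))"
    using cp by simp
  also have "\<dots> = (\<Sum>t<T. ln ((exp c + 4 * real T) * exp (L - b * real t)))"
    by (rule ln_prod, simp) (metis pos exp_gt_zero mult_pos_pos less_irrefl)
  also have "\<dots> = (\<Sum>t<T. (ln (exp c + 4 * real T) + L) - b * real t)"
    by (intro sum.cong refl) (subst ln_mult, use pos in auto)
  also have "\<dots> = real T * (ln (exp c + 4 * real T) + L) - b * (real T * (real T - 1) / 2)"
    by (simp add: sum_subtractf sum_distrib_left[symmetric] sum_of_nat_lessThan)
  finally show ?thesis using S that by blast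
qed

lemma exp_decaying_covering_log_card_ge:
  fixes a b \<epsilon> :: real
  assumes "a > 0" "b > 0" "\<epsilon> > 0"
    and S: "is_covering \<epsilon> (exp_decaying_systems a b) lti_dist S"
  shows "real T * (ln (a / \<epsilon>) - ln 3) - b * (real T * (real T - 1) / 2) \<le> ln (real (card S))"
proof -
  have "(\<Prod>t<T. a * exp (- b * real t) / (3 * \<epsilon>)) \<le> real (card S)"
    by (rule exp_decaying_covering_card_ge[OF assms])
  moreover have "0 < (\<Prod>t<T. a * exp (- b * real t) / (3 * \<epsilon>))"
    using assms by (intro prod_pos) auto
  ultimately have "ln (\<Prod>t<T. a * exp (- b * real t) / (3 * \<epsilon>)) \<le> ln (real (card S))"
    by simp
  moreover have "ln (\<Prod>t<T. a * exp (- b * real t) / (3 * \<epsilon>)) = (\<Sum>t<T. ln (a * exp (- b * real t) / (3 * \<epsilon>)))"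
    using assms by (intro ln_prod) auto
  moreover have "\<dots> = (\<Sum>t<T. (ln (a / \<epsilon>) - ln 3) - b * real t)"
    using assms by (intro sum.cong refl) (simp add: ln_mult ln_div)
  moreover have "\<dots> = real T * (ln (a / \<epsilon>) - ln 3) - b * (real T * (real T - 1) / 2)"
    by (simp add: sum_subtractf sum_distrib_left[symmetric] sum_of_nat_lessThan)
  ultimately show ?thesis by simp
qed

text \<open>
  The number of coordinates is \<open>T = \<lceil>(L + c) / b\<rceil>\<close> for the covering and \<open>R = \<lfloor>L / b\<rfloor>\<close> for the
  packing; the bounds are rounded so as to become elementary functions of \<open>L\<close>.
\<close>

lemma log_covering_number_bounds:
  fixes a b \<epsilon> :: real
  assumes "a > 0" "b > 0" "\<epsilon> > 0"
  defines "L \<equiv> ln (a / \<epsilon>)" and "c \<equiv> ln (2 / (1 - exp (- b)))"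
  defines "N \<equiv> real (covering_number \<epsilon> (exp_decaying_systems a b) lti_dist)"
  assumes L: "ln 3 \<le> L" 
  shows "ln N \<le> ((L + c) / b + 1) * (ln (exp c + 4 * ((L + c) / b + 1)) + L) - b * (((L + c) / b) * ((L + c) / b - 1) / 2)"
    and "(L / b - 1) * (L - ln 3) - L\<^sup>2 / (2 * b) \<le> ln N"
proof -
  have c: "c > 0" unfolding c_def using assms(2) by (intro ln_gt_zero) (simp add: field_simps add_pos_pos)
  have L0: "L > 0" using L ln_gt_zero[of "3::real"] by linarith
  define V where "V = (L + c) / b"
  have V: "V > 0" using c L0 assms(2) by (simp add: V_def)
  define T where "T = nat \<lceil>V\<rceil>"
  have T: "T > 0" "V \<le> real T" "real T < V + 1" using V by (auto simp: T_def) linarith+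
  obtain S where S: "is_covering \<epsilon> (exp_decaying_systems a b) lti_dist S"
    and card: "ln (real (card S)) \<le> real T * (ln (exp c + 4 * real T) + L) - b * (real T * (real T - 1) / 2)"
    using exp_decaying_covering_log_card[OF assms(1-3), of T] T unfolding V_def c_def L_def by blast
  obtain S' where S': "is_covering \<epsilon> (exp_decaying_systems a b) lti_dist S'" "N = real (card S')"
    using covering_number_attained[OF S] unfolding N_def by metis
  have "(\<lambda>t. 0) \<in> exp_decaying_systems a b" using assms(1) by (simp add: exp_decaying_systems_def)
  then have "S' \<noteq> {}" using S' by (auto simp: is_covering_def)
  then have N0: "N > 0" using S' by (auto simp: is_covering_def card_gt_0_iff)
  have "N \<le> real (card S)" unfolding N_def using covering_number_le[OF S] by simp
  then have "ln N \<le> ln (real (card S))" using N0 by simp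
  moreover note card
  moreover have "real T * (ln (exp c + 4 * real T) + L) \<le> (V + 1) * (ln (exp c + 4 * (V + 1)) + L)"
  proof (rule mult_mono)
    have "1 \<le> exp c + 4 * real T" using c by (smt (verit) one_le_exp_iff of_nat_0_le_iff)
    then show "0 \<le> ln (exp c + 4 * real T) + L" using L0 by simp
    have "0 < exp c + 4 * real T" by (intro add_pos_nonneg) auto
    then show "ln (exp c + 4 * real T) + L \<le> ln (exp c + 4 * (V + 1)) + L" using T by simp
  qed (use T V in auto)
  moreover have "V * (V - 1) \<le> real T * (real T - 1)"
  proof -
    have "real T * (real T - 1) - V * (V - 1) = (real T - V) * (real T + V - 1)" by (simp add: algebra_simps)
    moreover have "real T \<ge> 1" using T by simp
    ultimately show ?thesis using T V by (smt (verit) mult_nonneg_nonneg)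
  qed
  then have "b * (V * (V - 1) / 2) \<le> b * (real T * (real T - 1) / 2)" using assms(2) by simp
  ultimately show "ln N \<le> ((L + c) / b + 1) * (ln (exp c + 4 * ((L + c) / b + 1)) + L) - b * (((L + c) / b) * ((L + c) / b - 1) / 2)"
    unfolding V_def by linarith
  define R where "R = nat \<lfloor>L / b\<rfloor>"
  have "L / b > 0" using L0 assms(2) by simp
  then have R: "real R \<le> L / b" "L / b - 1 \<le> real R" by (auto simp: R_def of_nat_nat) 
  have "(L / b - 1) * (L - ln 3) \<le> real R * (L - ln 3)" using R L by (intro mult_right_mono) auto
  moreover have "b * (real R * (real R - 1) / 2) \<le> L\<^sup>2 / (2 * b)"
  proof -
    have "real R * (real R - 1) \<le> (L / b) * (L / b)" 
    proof -
      have "real R * (real R - 1) \<le> real R * real R" by (intro mult_left_mono) auto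
      also have "\<dots> \<le> (L / b) * (L / b)" using R by (intro mult_mono') auto
      finally show ?thesis .
    qed
    then have "b * (real R * (real R - 1) / 2) \<le> b * ((L / b) * (L / b) / 2)"
      using assms(2) by (intro mult_left_mono divide_right_mono) auto
    also have "\<dots> = L\<^sup>2 / (2 * b)" using assms(2) by (simp add: field_simps power2_eq_square)
    finally show ?thesis .
  qed
  moreover have "real R * (L - ln 3) - b * (real R * (real R - 1) / 2) \<le> ln N"
    using exp_decaying_covering_log_card_ge[OF assms(1-3) S'(1), of R] S'(2) by (simp add: L_def)
  ultimately show "(L / b - 1) * (L - ln 3) - L\<^sup>2 / (2 * b) \<le> ln N" by linarith
qed

lemma log_covering_upper_bound_asymp:
  fixes b c :: real
  assumes "b > 0" "c > 0"
  shows "((\<lambda>L. (((L + c) / b + 1) * (ln (exp c + 4 * ((L + c) / b + 1)) + L) - b * (((L + c) / b) * ((L + c) / b - 1) / 2)) / (L\<^sup>2 / (2 * b))) \<longlongrightarrow> 1) at_top"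
  using assms by real_asymp

lemma log_covering_lower_bound_asymp:
  fixes b :: real
  assumes "b > 0"
  shows "((\<lambda>L. ((L / b - 1) * (L - ln 3) - L\<^sup>2 / (2 * b)) / (L\<^sup>2 / (2 * b))) \<longlongrightarrow> 1) at_top"
  using assms by real_asymp

lemma entropy_asymptotics:
  fixes a b :: real
  assumes "a > 0" and "b > 0"
  shows "((\<lambda>\<epsilon>. \<bar>metric_entropy \<epsilon> (exp_decaying_systems a b) lti_dist
              / (log 2 (exp 1) / (2 * b) * (ln (a / \<epsilon>))\<^sup>2)\<bar>) \<longlongrightarrow> 1) (at_right 0)"
proof -
  define c where "c = ln (2 / (1 - exp (- b)))"
  have c: "c > 0" unfolding c_def using assms(2) by (intro ln_gt_zero) (simp add: field_simps add_pos_pos)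
  define N where "N = (\<lambda>\<epsilon>. real (covering_number \<epsilon> (exp_decaying_systems a b) lti_dist))"
  define L where "L = (\<lambda>\<epsilon>. ln (a / \<epsilon>))"
  have L: "filterlim L at_top (at_right 0)" unfolding L_def using assms(1) by real_asymp
  have eq: "metric_entropy \<epsilon> (exp_decaying_systems a b) lti_dist / (log 2 (exp 1) / (2 * b) * (ln (a / \<epsilon>))\<^sup>2)
      = ln (N \<epsilon>) / ((L \<epsilon>)\<^sup>2 / (2 * b))" for \<epsilon>
    by (simp add: metric_entropy_def log_def N_def L_def)
  have ev: "eventually (\<lambda>\<epsilon>. \<epsilon> > 0 \<and> ln 3 \<le> L \<epsilon>) (at_right 0)"
    using L[unfolded filterlim_at_top] by (intro eventually_conj eventually_at_right_less) blast
  have "((\<lambda>\<epsilon>. ln (N \<epsilon>) / ((L \<epsilon>)\<^sup>2 / (2 * b))) \<longlongrightarrow> 1) (at_right 0)"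
  proof (rule tendsto_sandwich)
    show "\<forall>\<^sub>F \<epsilon> in at_right 0. ((L \<epsilon> / b - 1) * (L \<epsilon> - ln 3) - (L \<epsilon>)\<^sup>2 / (2 * b)) / ((L \<epsilon>)\<^sup>2 / (2 * b))
        \<le> ln (N \<epsilon>) / ((L \<epsilon>)\<^sup>2 / (2 * b))"
      using ev by (rule eventually_mono)
        (use log_covering_number_bounds(2)[OF assms] assms(2) in \<open>auto simp: N_def L_def intro!: divide_right_mono\<close>)
    show "\<forall>\<^sub>F \<epsilon> in at_right 0. ln (N \<epsilon>) / ((L \<epsilon>)\<^sup>2 / (2 * b)) \<le>
       (((L \<epsilon> + c) / b + 1) * (ln (exp c + 4 * ((L \<epsilon> + c) / b + 1)) + L \<epsilon>)
          - b * (((L \<epsilon> + c) / b) * ((L \<epsilon> + c) / b - 1) / 2)) / ((L \<epsilon>)\<^sup>2 / (2 * b))"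
      using ev by (rule eventually_mono)
        (use log_covering_number_bounds(1)[OF assms, folded c_def] assms(2) in \<open>auto simp only: N_def L_def intro!: divide_right_mono\<close>, simp)
  qed (use filterlim_compose[OF log_covering_upper_bound_asymp[OF assms(2) c] L] filterlim_compose[OF log_covering_lower_bound_asymp[OF assms(2)] L] in auto)
  from tendsto_rabs[OF this] show ?thesis by (simp only: eq abs_one)
qed

theorem mainTheorem1:
  fixes a b :: real
  assumes "a > 0" and "b > 0"
  shows "Metric_space hardy_systems lti_dist
    \<and> compactin (Metric_space.mtopology hardy_systems lti_dist) (exp_decaying_systems a b)
    \<and> (\<forall>k\<in>hardy_systems. \<forall>k'\<in>hardy_systems.
         ereal (lti_dist k k')
           = hardy_norm (\<lambda>z. transfer_function k z - transfer_function k' z)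
       \<and> ereal (lti_dist k k')
           = (SUP x\<in>{x :: nat \<Rightarrow> real. l2_norm x = 1}. l2_norm (lti_apply (\<lambda>t. k t - k' t) x))
       \<and> ereal (lti_dist k k')
           = (SUP x\<in>{x :: nat \<Rightarrow> complex. l2_norm x = 1}. l2_norm (lti_apply (\<lambda>t. k t - k' t) x)))
    \<and> ((\<lambda>\<epsilon>. \<bar>metric_entropy \<epsilon> (exp_decaying_systems a b) lti_dist
              / (log 2 (exp 1) / (2 * b) * (ln (a / \<epsilon>))\<^sup>2)\<bar>) \<longlongrightarrow> 1) (at_right 0)"
  by (intro conjI ballI Metric_space_hardy compactin_exp_decaying[OF assms(2)] ereal_lti_dist
      lti_dist_eq_l2_gain entropy_asymptotics[OF assms])

end
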